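(* For every $n\ge1$, with $X_n=E_n\setminus L_n$, $$|X_n|=|E_n|-|L_n|=\frac{16^n+3\cdot4^n-4\cdot7^n}{12}.$$ The first values (for $n=1,\dots,6$) are $0,9,243,4725,82035,1359909$. Moreover, as $n\to\infty$, $$\frac{|L_n|}{|E_n|}\sim 4\left(\frac{7}{16}\right)^n .$$
   Context: $\Delta_n=\{i,j,k,e\}^n$ is the set of words $b=b_1b_2\cdots b_n$ of length $n$ in the four symbols $i,j,k,e$. Put $v(i)=(\cos 210^\circ,\sin 210^\circ)$, $v(j)=(\cos 90^\circ,\sin 90^\circ)$, $v(k)=(\cos 330^\circ,\sin 330^\circ)$, $v(e)=(0,0)$ in $\mathbb R^2$. Fix a real $d_1>0$ and put $d_r=d_1/2^{r-1}$. The centroid map $P:\Delta_n\to\mathbb R^2$ is $$P(b)=\sum_{r=1}^n \sigma_r(b)\,d_r\,v(b_r),\qquad \sigma_r(b)=(-1)^{\#\{s<r:\ b_s=e\}}.$$ $E_n$ is the set of unordered triples $\{b_1,b_2,b_3\}$ of distinct words in $\Delta_n$ such that $P(b_1),P(b_2),P(b_3)$ are the vertices of a nondegenerate equilateral triangle. For $b\in\Delta_n$ put $\mathrm{supp}(b)=\{r: b_r\ne e\}$. Let $\gamma$ be the permutation $i\mapsto j\mapsto k\mapsto i$, $e\mapsto e$. For nonempty $S\subseteq\mathrm{supp}(b)$, $\gamma_S(b)$ is obtained by applying $\gamma$ in the coordinates of $S$ and fixing the others, and $T(b,S)=\{b,\gamma_S(b),\gamma_S^2(b)\}$, which is always an element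 of $E_n$. The local class is $L_n=\{T(b,S): b\in\Delta_n,\ \varnothing\ne S\subseteq\mathrm{supp}(b)\}\subseteq E_n$. *)

theory Defs
  imports "HOL-Analysis.Analysis" "HOL-Library.Landau_Symbols"
begin

datatype symb = Qi | Qj | Qk | Qe

definition deg :: "real \<Rightarrow> real" where
  "deg x = x * pi / 180"

primrec v :: "symb \<Rightarrow> real ^ 2" where
  "v Qi = vector [cos (deg 210), sin (deg 210)]"
| "v Qj = vector [cos (deg 90), sin (deg 90)]"
| "v Qk = vector [cos (deg 330), sin (deg 330)]"
| "v Qe = vector [0, 0]"

text \<open>A word $b_1 \ldots b_n$ is a list, whose positions are counted from 0: the letter $b_r$
  is \<open>b ! (r - 1)\<close>. Subscripts of \<open>sgn_at\<close> and \<open>supp\<close> below are such 0-based positions,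
  while \<open>dlen d1 r\<close> is $d_r$ itself, with the 1-based index.\<close>

definition words :: "nat \<Rightarrow> symb list set" where
  "words n = {b. length b = n}"

definition dlen :: "real \<Rightarrow> nat \<Rightarrow> real" where
  "dlen d1 r = d1 / 2 ^ (r - 1)"

definition sgn_at :: "symb list \<Rightarrow> nat \<Rightarrow> real" where
  "sgn_at b r = (- 1) ^ card {s. s < r \<and> b ! s = Qe}"

definition centroid :: "real \<Rightarrow> symb list \<Rightarrow> real ^ 2" where
  "centroid d1 b = (\<Sum>r<length b. (sgn_at b r * dlen d1 (r + 1)) *\<^sub>R v (b ! r))"

definition equilateral :: "real ^ 2 \<Rightarrow> real ^ 2 \<Rightarrow> real ^ 2 \<Rightarrow> bool" where
  "equilateral A B C \<longleftrightarrow>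
     \<not> collinear {A, B, C} \<and> dist A B = dist B C \<and> dist B C = dist C A"

definition E_set :: "real \<Rightarrow> nat \<Rightarrow> symb list set set" where
  "E_set d1 n = {{b1, b2, b3} | b1 b2 b3.
     b1 \<in> words n \<and> b2 \<in> words n \<and> b3 \<in> words n \<and> distinct [b1, b2, b3] \<and>
     equilateral (centroid d1 b1) (centroid d1 b2) (centroid d1 b3)}"

definition supp :: "symb list \<Rightarrow> nat set" where
  "supp b = {r. r < length b \<and> b ! r \<noteq> Qe}"

primrec gam :: "symb \<Rightarrow> symb" where
  "gam Qi = Qj"
| "gam Qj = Qk"
| "gam Qk = Qi"
| "gam Qe = Qe"

definition gam_on :: "nat set \<Rightarrow> symb list \<Rightarrow> symb list" where
  "gam_on S b = map (\<lambda>r. if r \<in> S then gam (b ! r) else b ! r) [0..<length b]"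

definition T_set :: "symb list \<Rightarrow> nat set \<Rightarrow> symb list set" where
  "T_set b S = {b, gam_on S b, gam_on S (gam_on S b)}"

definition L_set :: "nat \<Rightarrow> symb list set set" where
  "L_set n = {T_set b S | b S. b \<in> words n \<and> S \<noteq> {} \<and> S \<subseteq> supp b}"

definition X_set :: "real \<Rightarrow> nat \<Rightarrow> symb list set set" where
  "X_set d1 n = E_set d1 n - L_set n"

end

theory Submission imports Defs
begin

text \<open>
  Cut a large equilateral triangle into $4^n$ small congruent ones by halving the sides $n$ times.
  The words of length $n$ address these small triangles (the letter \<open>e\<close> selects the middle piece,
  which is turned upside down, whence the signs $\sigma_r$), and $P$ sends a word to the centre of
  its small triangle. A small triangle is also determined by the numbers $(a, b, c)$ of strips that
  separate it from the three sides; with $m = 2^n$, the small triangles pointing up are the triples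
  of natural numbers with sum $m - 1$, those pointing down the triples with sum $m - 2$
  (\<open>cell_image_words\<close>), and $P$ is a multiple of
  $a\,v(i) + b\,v(j) + c\,v(k)$ (\<open>centroid_eq_lattice_point\<close>).

  The centres of the triangles pointing up and of those pointing down lie in two different cosets
  of the lattice spanned by the differences of $v(i)$, $v(j)$, $v(k)$. A rotation by $60$ degrees preserves this
  lattice, so an equilateral triangle with two vertices in one coset has the third there too; as
  there are only two cosets, its vertices all point the same way
  (\<open>equilateral_in_grid_triangles\<close>). Therefore $E_n$ counts the equilateral triangles, tilted ones
  included, in two triangular arrays of dots with $m$ and $m - 1$ dots on a side. Such a triangle is
  inscribed in a unique untilted one, and recording that one and the amount of tilt identifies the
  triangles of the array with $m$ dots on a side with the $5$-tuples of natural numbers of sum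
  $m - 2$, so there are $\binom{m+2}{4}$ of them. Altogether
  $|E_n| = \binom{m+2}{4} + \binom{m+1}{4} = (16^n - 4^n)/12$ (\<open>finite_card_E_set\<close>).

  For $L_n$, a pair $(b, S)$ amounts to a choice in each coordinate among $4$ letters outside $S$ or
  $3$ letters inside $S$; there are $7^n$ such choices and $4^n$ of them have $S = \emptyset$. Each
  $T(b, S)$ determines $S$ and arises from exactly three values of $b$, so
  $|L_n| = (7^n - 4^n)/3$ (\<open>card_L_set\<close>). Finally $L_n \subseteq E_n$ since $\gamma$ acts on
  the vectors $v$ as a rotation by $120$ degrees and keeps all signs $\sigma_r$
  (\<open>T_set_in_E_set\<close>).
\<close>

section \<open>Words as cells of a triangular board\<close>

text \<open>The strip coordinates of the small triangle addressed by a word. A corner letter moves the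
  half-size board by its side $h$ in one direction; the middle board is upside down, so its
  coordinates $x$ become $h - 1 - x$.\<close>

primrec cell :: "symb list \<Rightarrow> int \<times> int \<times> int" where
  "cell [] = (0, 0, 0)"
| "cell (x # w) = (case cell w of (a, b, c) \<Rightarrow> (case x of
      Qi \<Rightarrow> (a + 2 ^ length w, b, c)
    | Qj \<Rightarrow> (a, b + 2 ^ length w, c)
    | Qk \<Rightarrow> (a, b, c + 2 ^ length w)
    | Qe \<Rightarrow> (2 ^ length w - 1 - a, 2 ^ length w - 1 - b, 2 ^ length w - 1 - c)))"

definition grid :: "int \<Rightarrow> (int \<times> int \<times> int) set" where
  "grid s = {(a, b, c). 0 \<le> a \<and> 0 \<le> b \<and> 0 \<le> c \<and> a + b + c = s}"

definition board :: "nat \<Rightarrow> (int \<times> int \<times> int) set" where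
  "board n = grid (2 ^ n - 1) \<union> grid (2 ^ n - 2)"

lemma words_Suc: "words (Suc n) = (\<lambda>(x, w). x # w) ` (UNIV \<times> words n)"
  by (auto simp: words_def length_Suc_conv image_iff)

lemma UNIV_symb: "UNIV = {Qi, Qj, Qk, Qe}"
  by (auto intro: symb.exhaust)

lemma finite_words: "finite (words n)" and card_words: "card (words n) = 4 ^ n"
proof -
  have "finite (UNIV :: symb set)" "card (UNIV :: symb set) = 4" by (simp_all add: UNIV_symb)
  then show "finite (words n)" "card (words n) = 4 ^ n"
    using finite_lists_length_eq[of "UNIV :: symb set" n] card_lists_length_eq[of "UNIV :: symb set" n]
    by (simp_all add: words_def)
qed

lemma cell_in_board: "cell w \<in> board (length w)"
proof (induction w)
  case (Cons x w)
  obtain a b c where "cell w = (a, b, c)" by (cases "cell w")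
  with Cons show ?case
    by (cases x) (auto simp: board_def grid_def)
qed (simp add: board_def grid_def)

text \<open>The first letter can be read off: one coordinate is at least half the side of the board, and
  this can happen for only one of them, unless the letter is \<open>Qe\<close>.\<close>

lemma cell_inj:
  "length w = length w' \<Longrightarrow> cell w = cell w' \<Longrightarrow> w = w'"
proof (induction w w' rule: list_induct2)
  case (Cons x w y w')
  obtain a b c where c: "cell w = (a, b, c)" by (cases "cell w")
  obtain a' b' c' where c': "cell w' = (a', b', c')" by (cases "cell w'")
  have "x = y \<and> cell w = cell w'"
    using Cons.prems Cons.hyps cell_in_board[of w] cell_in_board[of w']
    by (cases x; cases y) (auto simp: c c' board_def grid_def)
  with Cons.IH show ?case by simp
qed simp

text \<open>Every small triangle lies in a corner board or in the middle board, depending on which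
  coordinate reaches half the side; undoing the corresponding move leads back to a board of half
  the size.\<close>

lemma board_subset_cell: "board n \<subseteq> cell ` words n"
proof (induction n)
  case 0
  show ?case by (auto simp: board_def grid_def words_def)
next
  case (Suc n)
  let ?h = "2 ^ n :: int"
  have step: "\<exists>w. length w = n \<and> cell w = (a, b, c)" if "(a, b, c) \<in> board n" for a b c
    using Suc that unfolding words_def by (metis (mono_tags, lifting) imageE mem_Collect_eq subsetD)
  have "(a, b, c) \<in> cell ` words (Suc n)" if abc: "(a, b, c) \<in> board (Suc n)" for a b c
  proof -
    have "\<exists>x w. length w = n \<and> cell (x # w) = (a, b, c)"
    proof -
      consider "a \<ge> ?h" | "b \<ge> ?h" | "c \<ge> ?h" | "a < ?h" "b < ?h" "c < ?h" by linarith
      then show ?thesis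
      proof cases
        case 1
        then have "(a - ?h, b, c) \<in> board n" using abc by (auto simp: board_def grid_def)
        then obtain w where "length w = n" "cell w = (a - ?h, b, c)" using step by blast
        then have "cell (Qi # w) = (a, b, c)" by simp
        with \<open>length w = n\<close> show ?thesis by blast
      next
        case 2
        then have "(a, b - ?h, c) \<in> board n" using abc by (auto simp: board_def grid_def)
        then obtain w where "length w = n" "cell w = (a, b - ?h, c)" using step by blast
        then have "cell (Qj # w) = (a, b, c)" by simp
        with \<open>length w = n\<close> show ?thesis by blast
      next
        case 3
        then have "(a, b, c - ?h) \<in> board n" using abc by (auto simp: board_def grid_def)
        then obtain w where "length w = n" "cell w = (a, b, c - ?h)" using step by blast
        then have "cell (Qk # w) = (a, b, c)" by simp
        with \<open>length w = n\<close> show ?thesis by blast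
      next
        case 4
        then have "(?h - 1 - a, ?h - 1 - b, ?h - 1 - c) \<in> board n"
          using abc by (auto simp: board_def grid_def)
        then obtain w where "length w = n" "cell w = (?h - 1 - a, ?h - 1 - b, ?h - 1 - c)"
          using step by blast
        then have "cell (Qe # w) = (a, b, c)" by simp
        with \<open>length w = n\<close> show ?thesis by blast
      qed
    qed
    then obtain x w where "length w = n" "cell (x # w) = (a, b, c)" by blast
    then show ?thesis unfolding words_def image_iff
      by (intro bexI[of _ "x # w"]) auto
  qed
  then show ?case by auto
qed

lemma inj_on_cell: "inj_on cell (words n)"
  by (rule inj_onI) (auto simp: words_def intro: cell_inj)

lemma cell_image_words: "cell ` words n = board n"
  using board_subset_cell cell_in_board by (auto simp: words_def)

section \<open>The centroid map in board coordinates\<close>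

lemma v_components:
  "v Qi $ 1 = - sqrt 3 / 2" "v Qi $ 2 = - 1 / 2"
  "v Qj $ 1 = 0" "v Qj $ 2 = 1"
  "v Qk $ 1 = sqrt 3 / 2" "v Qk $ 2 = - 1 / 2"
  "v Qe = 0"
proof -
  have "deg 210 = pi / 6 + pi" by (simp add: deg_def)
  then have i: "cos (deg 210) = - (sqrt 3 / 2)" "sin (deg 210) = - (1 / 2)"
    by (simp_all only: cos_periodic_pi sin_periodic_pi cos_30 sin_30)
  have "deg 330 = 2 * pi - pi / 6" by (simp add: deg_def)
  then have k: "cos (deg 330) = sqrt 3 / 2" "sin (deg 330) = - (1 / 2)"
    by (simp_all only: cos_2pi_minus sin_2pi_minus cos_minus sin_minus cos_30 sin_30)
  have j: "deg 90 = pi / 2" by (simp add: deg_def)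
  show "v Qi $ 1 = - sqrt 3 / 2" "v Qi $ 2 = - 1 / 2"
    by (simp_all add: i)
  show "v Qj $ 1 = 0" "v Qj $ 2 = 1" by (simp_all add: j)
  show "v Qk $ 1 = sqrt 3 / 2" "v Qk $ 2 = - 1 / 2"
    by (simp_all add: k)
  show "v Qe = 0" by (simp add: vec_eq_iff forall_2)
qed

definition lattice_point :: "int \<times> int \<times> int \<Rightarrow> real ^ 2" where
  "lattice_point = (\<lambda>(a, b, c). of_int a *\<^sub>R v Qi + of_int b *\<^sub>R v Qj + of_int c *\<^sub>R v Qk)"

lemma centroid_Cons:
  "centroid d (x # w) = d *\<^sub>R v x + (if x = Qe then - 1 else 1) *\<^sub>R centroid (d / 2) w"
proof -
  have sgn: "sgn_at (x # w) (Suc r) = (if x = Qe then - 1 else 1) * sgn_at w r" for r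
  proof -
    have "{s. s < Suc r \<and> (x # w) ! s = Qe}
        = (if x = Qe then {0} else {}) \<union> Suc ` {s. s < r \<and> w ! s = Qe}" (is "?l = ?r")
    proof (rule set_eqI)
      show "s \<in> ?l \<longleftrightarrow> s \<in> ?r" for s by (cases s) auto
    qed
    moreover have "card ((if x = Qe then {0} else {}) \<union> Suc ` {s. s < r \<and> w ! s = Qe})
        = (if x = Qe then 1 else 0) + card {s. s < r \<and> w ! s = Qe}"
      by (subst card_Un_disjoint) (auto simp: card_image)
    ultimately show ?thesis by (simp add: sgn_at_def)
  qed
  have dlen: "dlen d (Suc (Suc r)) = dlen (d / 2) (Suc r)" for r
    by (simp add: dlen_def)
  have zero: "sgn_at (x # w) 0 = 1" "dlen d (Suc 0) = d"
    by (simp_all add: sgn_at_def dlen_def)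
  have "centroid d (x # w)
      = d *\<^sub>R v x + (\<Sum>r<length w. (sgn_at (x # w) (Suc r) * dlen d (Suc (Suc r))) *\<^sub>R v (w ! r))"
    by (simp add: centroid_def sum.lessThan_Suc_shift zero del: sum.lessThan_Suc)
  then show ?thesis
    by (simp add: sgn dlen centroid_def scaleR_sum_right sum_negf)
qed

text \<open>The offset $h - 1$ that the letter \<open>Qe\<close> adds to all three coordinates is invisible in the
  plane because the three corner vectors sum to zero, so only the change of sign remains.\<close>

lemma centroid_eq_lattice_point:
  "centroid d w = (2 * d / 2 ^ length w) *\<^sub>R lattice_point (cell w)"
proof (induction w arbitrary: d)
  case Nil
  show ?case by (simp add: centroid_def lattice_point_def)
next
  case (Cons x w)
  obtain a b c where c: "cell w = (a, b, c)" by (cases "cell w")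
  show ?case
    unfolding centroid_Cons Cons.IH
    by (cases x) (auto simp: c lattice_point_def vec_eq_iff forall_2 v_components field_simps simp del: v.simps)
qed


text \<open>The squared length of the vector with coordinates $(x, y, z)$. Since the coordinates matter only
  modulo $(1, 1, 1)$, this form is degenerate along that direction. It makes being equilateral a
  question about integers.\<close>

definition hex_form :: "int \<times> int \<times> int \<Rightarrow> int" where
  "hex_form = (\<lambda>(x, y, z). x\<^sup>2 + y\<^sup>2 + z\<^sup>2 - x * y - y * z - z * x)"

lemma lattice_point_diff: "lattice_point p - lattice_point q = lattice_point (p - q)"
  by (cases p; cases q) (simp add: lattice_point_def algebra_simps)

lemma norm_lattice_point: "(norm (lattice_point p))\<^sup>2 = of_int (hex_form p)"
proof -
  obtain x y z where p: "p = (x, y, z)" by (cases p)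
  have "(norm (lattice_point p))\<^sup>2 = (lattice_point p $ 1)\<^sup>2 + (lattice_point p $ 2)\<^sup>2"
    unfolding power2_norm_eq_inner by (simp add: inner_vec_def sum_2 power2_eq_square)
  also have "\<dots> = (sqrt 3 / 2 * (of_int z - of_int x))\<^sup>2 + (of_int y - (of_int x + of_int z) / 2)\<^sup>2"
  proof -
    have "lattice_point p $ 1 = sqrt 3 / 2 * (of_int z - of_int x)"
      "lattice_point p $ 2 = of_int y - (of_int x + of_int z) / 2"
      by (simp_all add: p lattice_point_def v_components field_simps del: v.simps)
    then show ?thesis by (simp only:)
  qed
  also have "\<dots> = of_int (hex_form p)"
  proof -
    have "(sqrt 3 / 2)\<^sup>2 = (3 / 4 :: real)" by (simp add: power_divide)
    then show ?thesis unfolding power_mult_distrib p hex_form_def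
      by (simp add: power2_eq_square field_simps)
  qed
  finally show ?thesis .
qed

lemma dist_centroid:
  assumes "d > 0" "w \<in> words n" "w' \<in> words n"
  shows "dist (centroid d w) (centroid d w')
    = 2 * d / 2 ^ n * sqrt (of_int (hex_form (cell w - cell w')))"
proof -
  have "dist (centroid d w) (centroid d w') = norm ((2 * d / 2 ^ n) *\<^sub>R lattice_point (cell w - cell w'))"
    using assms by (simp add: centroid_eq_lattice_point words_def dist_norm
        scaleR_diff_right flip: lattice_point_diff)
  also have "norm (lattice_point (cell w - cell w')) = sqrt (of_int (hex_form (cell w - cell w')))"
    by (metis norm_lattice_point norm_ge_zero real_sqrt_abs abs_of_nonneg)
  then have "norm ((2 * d / 2 ^ n) *\<^sub>R lattice_point (cell w - cell w'))
      = 2 * d / 2 ^ n * sqrt (of_int (hex_form (cell w - cell w')))"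
    using assms by simp
  finally show ?thesis .
qed

lemma hex_form_eq_0: "hex_form (x, y, z) = 0 \<longleftrightarrow> x = y \<and> y = z"
proof -
  have "2 * hex_form (x, y, z) = (x - y)\<^sup>2 + (y - z)\<^sup>2 + (z - x)\<^sup>2"
    by (simp add: hex_form_def power2_eq_square algebra_simps)
  moreover have "(x - y)\<^sup>2 + (y - z)\<^sup>2 + (z - x)\<^sup>2 = 0 \<longleftrightarrow> x = y \<and> y = z"
    by (smt (verit) zero_le_power2 power2_eq_square mult_zero_left power_eq_0_iff)
  ultimately show ?thesis by linarith
qed

lemma hex_form_commute: "hex_form (p - q) = hex_form (q - p)"
  by (cases p; cases q) (simp add: hex_form_def power2_eq_square algebra_simps)

text \<open>Two triples that differ by a multiple of $(1, 1, 1)$ have sums differing by a multiple of $3$,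
  whereas the sums occurring on a board differ by at most $1$. This is why distinct words have
  distinct centroids.\<close>

lemma hex_form_board_pos:
  assumes "p \<in> board n" "q \<in> board n" "p \<noteq> q"
  shows "hex_form (p - q) \<noteq> 0"
  using assms by (cases p; cases q) (auto simp: hex_form_eq_0 board_def grid_def)

lemma equilateral_iff:
  "equilateral A B C \<longleftrightarrow> A \<noteq> B \<and> dist A B = dist B C \<and> dist B C = dist C A"
proof -
  have "\<not> collinear {A, B, C}" if "A \<noteq> B" and d: "dist A B = dist B C" "dist B C = dist C A"
    using that by (auto simp: collinear_between_cases between dist_commute)
  moreover have "collinear {A, B, C}" if "A = B" using that by (simp add: collinear_2)
  ultimately show ?thesis unfolding equilateral_def by blast
qed

lemma centroid_inj:
  assumes d: "d > 0" and w: "w1 \<in> words n" "w2 \<in> words n" and ne: "w1 \<noteq> w2"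
  shows "centroid d w1 \<noteq> centroid d w2"
proof -
  have "cell w1 \<noteq> cell w2" using ne w inj_on_cell by (metis inj_onD)
  then have "hex_form (cell w1 - cell w2) \<noteq> 0"
    using hex_form_board_pos w cell_image_words by (metis imageI)
  then have "dist (centroid d w1) (centroid d w2) \<noteq> 0"
    using d by (simp add: dist_centroid[OF d w])
  then show ?thesis by auto
qed

lemma equilateral_centroid_iff:
  assumes d: "d > 0" and w: "w1 \<in> words n" "w2 \<in> words n" "w3 \<in> words n" and ne: "w1 \<noteq> w2"
  shows "equilateral (centroid d w1) (centroid d w2) (centroid d w3) \<longleftrightarrow>
    hex_form (cell w1 - cell w2) = hex_form (cell w2 - cell w3) \<and>
    hex_form (cell w2 - cell w3) = hex_form (cell w3 - cell w1)"
  using d by (simp add: equilateral_iff centroid_inj[OF d w(1,2) ne] dist_centroid[OF d w(1,2)]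
      dist_centroid[OF d w(2,3)] dist_centroid[OF d w(3,1)])

section \<open>Equilateral triangles on the board\<close>

text \<open>For vectors with coordinate sum zero, rotation by $120$ degrees is the cyclic shift of the
  coordinates; an equilateral triangle is a closed path of three steps, each being the shift of
  the one before. Both ways round a triangle are such paths for opposite cyclic shifts, so it
  suffices to admit the shift $(x, y, z) \mapsto (z, x, y)$.\<close>

definition grid_triangles :: "int \<Rightarrow> (int \<times> int \<times> int) set set" where
  "grid_triangles s = {{p, p + (x, y, z), p + (x, y, z) + (z, x, y)} | p x y z.
     x + y + z = 0 \<and> (x, y, z) \<noteq> 0 \<and>
     p \<in> grid s \<and> p + (x, y, z) \<in> grid s \<and> p + (x, y, z) + (z, x, y) \<in> grid s}"

lemma grid_trianglesI:
  assumes "x + y + z = 0" "p \<noteq> q" "q = p + (x, y, z)" "r = q + (z, x, y)"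
    "p \<in> grid s" "q \<in> grid s" "r \<in> grid s"
  shows "{p, q, r} \<in> grid_triangles s"
proof -
  have "(x, y, z) \<noteq> 0" using assms(2,3) by auto
  then show ?thesis unfolding grid_triangles_def using assms by blast
qed

text \<open>Two sides of an equilateral triangle issuing from one vertex are related by a rotation through
  $60$ degrees in one of the two directions. Here $k$ is the ambiguity of coordinates modulo
  $(1, 1, 1)$.\<close>

lemma rotated_by_60_degrees:
  fixes x y z x' y' z' :: int
  assumes eq: "hex_form (x, y, z) = hex_form (x', y', z')"
      "hex_form (x, y, z) = hex_form ((x, y, z) - (x', y', z'))"
    and nz: "hex_form (x, y, z) \<noteq> 0"
  shows "\<exists>k. (x', y', z') = (k - y, k - z, k - x) \<or> (x', y', z') = (k - z, k - x, k - y)"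
proof -
  \<comment> \<open>Coordinates in the basis $v(i)$, $v(j)$. The squared lengths fix the inner product \<open>H\<close> of the two
    vectors and, through Lagrange's identity, the square of their cross product \<open>D\<close>; inner and
    cross product together determine the second vector from the first.\<close>
  define p q p' q' N where defs: "p = x - z" "q = y - z" "p' = x' - z'" "q' = y' - z'"
    "N = p\<^sup>2 - p * q + q\<^sup>2"
  have N: "hex_form (x, y, z) = N" "hex_form (x', y', z') = p'\<^sup>2 - p' * q' + q'\<^sup>2"
    "hex_form ((x, y, z) - (x', y', z')) = (p - p')\<^sup>2 - (p - p') * (q - q') + (q - q')\<^sup>2"
    by (simp_all add: defs hex_form_def power2_eq_square algebra_simps)
  have N': "N = p'\<^sup>2 - p' * q' + q'\<^sup>2" and "N = (p - p')\<^sup>2 - (p - p') * (q - q') + (q - q')\<^sup>2"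
    and "N \<noteq> 0" using eq nz N by simp_all
  then have H: "(2 * p - q) * p' + (2 * q - p) * q' = N"
    using defs(5) by (simp add: power2_eq_square algebra_simps)
  define D where "D = p * q' - q * p'"
  have "3 * D\<^sup>2 = 4 * (p\<^sup>2 - p * q + q\<^sup>2) * (p'\<^sup>2 - p' * q' + q'\<^sup>2) - ((2 * p - q) * p' + (2 * q - p) * q')\<^sup>2"
    unfolding D_def by algebra
  also have "\<dots> = 3 * N\<^sup>2"
    unfolding H N'[symmetric] defs(5)[symmetric] by algebra
  finally have "D\<^sup>2 = N\<^sup>2" by simp
  then consider "D = N" | "D = - N" by (auto simp: power2_eq_iff)
  then have "(p' = q \<and> q' = q - p) \<or> (p' = p - q \<and> q' = p)"
  proof cases
    case 1
    have "N * (p' - (p - q)) = 0" "N * (q' - p) = 0"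
      using H 1 defs(5) unfolding D_def by algebra+
    with \<open>N \<noteq> 0\<close> show ?thesis by simp
  next
    case 2
    have "N * (p' - q) = 0" "N * (q' - (q - p)) = 0"
      using H 2 defs(5) unfolding D_def by algebra+
    with \<open>N \<noteq> 0\<close> show ?thesis by simp
  qed
  then show ?thesis
  proof
    assume "p' = q \<and> q' = q - p"
    then show ?thesis by (intro exI[of _ "x' + z"]) (auto simp: defs)
  next
    assume "p' = p - q \<and> q' = p"
    then show ?thesis by (intro exI[of _ "x' + y"]) (auto simp: defs)
  qed
qed

text \<open>The three vertices have coordinate sums in a set of two consecutive numbers. If the sums of
  \<open>q\<close> and \<open>r\<close> exceed that of \<open>p\<close> by $\delta$ and $\delta'$, the rotation forces
  $\delta + \delta' \equiv 0 \pmod 3$, and $\delta$, $\delta'$ cannot have opposite signs; so both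
  vanish.\<close>

lemma equilateral_in_grid_triangles:
  assumes b: "p \<in> board n" "q \<in> board n" "r \<in> board n" and "p \<noteq> q"
    and h: "hex_form (p - q) = hex_form (q - r)" "hex_form (q - r) = hex_form (r - p)"
  shows "{p, q, r} \<in> grid_triangles (2 ^ n - 1) \<union> grid_triangles (2 ^ n - 2)"
proof -
  obtain a b c where p: "p = (a, b, c)" by (cases p)
  obtain x y z where e: "q - p = (x, y, z)" by (cases "q - p")
  obtain x' y' z' where f: "r - p = (x', y', z')" by (cases "r - p")
  have q: "q = (a + x, b + y, c + z)" and r: "r = (a + x', b + y', c + z')"
    using e f by (cases q; cases r; force simp: p)+
  have "hex_form (x, y, z) \<noteq> 0"
    using hex_form_board_pos[OF b(2,1)] \<open>p \<noteq> q\<close> e by simp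
  moreover have "hex_form (x, y, z) = hex_form (x', y', z')"
    using h hex_form_commute[of p q] by (simp add: e f)
  moreover have "(x, y, z) - (x', y', z') = q - r"
    by (simp add: q r)
  then have "hex_form (x, y, z) = hex_form ((x, y, z) - (x', y', z'))"
    using h hex_form_commute[of p q] by (simp add: e)
  ultimately obtain k where k:
    "(x', y', z') = (k - y, k - z, k - x) \<or> (x', y', z') = (k - z, k - x, k - y)"
    using rotated_by_60_degrees by blast
  define s where "s = a + b + c"
  have s: "s = 2 ^ n - 1 \<or> s = 2 ^ n - 2" and "p \<in> grid s"
    using b(1) by (auto simp: p s_def board_def grid_def)
  have sum: "x + y + z = 0 \<and> k = 0"
  proof -
    have "x' + y' + z' = 3 * k - (x + y + z)" using k by auto
    moreover have "a + b + c + (x + y + z) \<in> {2 ^ n - 1, 2 ^ n - 2}"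
      "a + b + c + (x' + y' + z') \<in> {2 ^ n - 1, 2 ^ n - 2}"
      using b by (auto simp: q r board_def grid_def)
    ultimately show ?thesis using s unfolding s_def by auto presburger+
  qed
  have grid: "q \<in> grid s" "r \<in> grid s"
    using b sum k by (auto simp: q r s_def board_def grid_def)
  from k have "{p, q, r} \<in> grid_triangles s"
  proof
    assume "(x', y', z') = (k - y, k - z, k - x)"
    then have r': "r = q + (z, x, y)" using sum by (auto simp: q r)
    have q': "q = p + (x, y, z)" by (simp add: p q)
    show ?thesis using sum \<open>p \<noteq> q\<close> \<open>p \<in> grid s\<close> grid r' q' by (intro grid_trianglesI) auto
  next
    assume "(x', y', z') = (k - z, k - x, k - y)"
    then have r': "r = p + (- z, - x, - y)" using sum by (auto simp: p r)
    \<comment> \<open>This triangle has the opposite orientation, so its path is started at \<open>q\<close>.\<close>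
    have p': "p = q + (- x, - y, - z)" by (simp add: p q)
    have "{q, p, r} \<in> grid_triangles s"
      using sum \<open>p \<noteq> q\<close> \<open>p \<in> grid s\<close> grid r' p'
      by (intro grid_trianglesI[of "- x" "- y" "- z"]) auto
    then show ?thesis by (simp only: insert_commute)
  qed
  then show ?thesis using s by auto
qed

lemma grid_triangle_equilateral:
  assumes "T \<in> grid_triangles s"
  obtains N where "\<And>p q. p \<in> T \<Longrightarrow> q \<in> T \<Longrightarrow> p \<noteq> q \<Longrightarrow> hex_form (p - q) = N"
proof -
  obtain p x y z where T: "T = {p, p + (x, y, z), p + (x, y, z) + (z, x, y)}" and "x + y + z = 0"
    using assms unfolding grid_triangles_def by blast
  then have z: "z = - x - y" by simp
  have "hex_form (q - r) = hex_form (x, y, z)" if "q \<in> T" "r \<in> T" "q \<noteq> r" for q r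
    using that unfolding T
    by (cases p) (auto simp: z hex_form_def power2_eq_square algebra_simps)
  then show ?thesis using that by blast
qed

lemma grid_triangle_three_cells:
  assumes "T \<in> grid_triangles s"
  obtains p q r where "T = {p, q, r}" "distinct [p, q, r]" "{p, q, r} \<subseteq> grid s"
proof -
  obtain p x y z where *: "T = {p, p + (x, y, z), p + (x, y, z) + (z, x, y)}" "x + y + z = 0"
    "(x, y, z) \<noteq> 0" "T \<subseteq> grid s"
    using assms unfolding grid_triangles_def by blast
  moreover have "distinct [p, p + (x, y, z), p + (x, y, z) + (z, x, y)]"
    using *(2,3) by (cases p) (auto simp: zero_prod_def)
  ultimately show ?thesis using that by blast
qed

lemma grid_triangles_disjoint:
  assumes "s \<noteq> t"
  shows "grid_triangles s \<inter> grid_triangles t = {}"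
proof (rule equals0I)
  fix T assume T: "T \<in> grid_triangles s \<inter> grid_triangles t"
  obtain p q r where "T = {p, q, r}" "{p, q, r} \<subseteq> grid s"
    using T grid_triangle_three_cells by blast
  moreover obtain p' q' r' where "T = {p', q', r'}" "{p', q', r'} \<subseteq> grid t"
    using T grid_triangle_three_cells by blast
  ultimately have "p \<in> grid s \<inter> grid t" by blast
  with assms show False by (auto simp: grid_def)
qed

text \<open>A set of words may be replaced by its set of cells as \<open>cell\<close> is injective on words of a fixed
  length, and centroids form an equilateral triangle exactly if the differences of the cells have
  equal \<open>hex_form\<close>.\<close>

lemma bij_betw_E_set:
  assumes d: "d > 0"
  shows "bij_betw (image cell) (E_set d n) (grid_triangles (2 ^ n - 1) \<union> grid_triangles (2 ^ n - 2))"
  unfolding bij_betw_def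
proof
  have "E_set d n \<subseteq> Pow (words n)" by (auto simp: E_set_def)
  then show "inj_on (image cell) (E_set d n)"
    using inj_on_image_Pow[OF inj_on_cell] inj_on_subset by blast
  show "image cell ` E_set d n = grid_triangles (2 ^ n - 1) \<union> grid_triangles (2 ^ n - 2)" (is "_ = ?G")
  proof
    show "image cell ` E_set d n \<subseteq> ?G"
    proof
      fix T assume "T \<in> image cell ` E_set d n"
      then obtain w1 w2 w3 where w: "w1 \<in> words n" "w2 \<in> words n" "w3 \<in> words n"
        and ne: "distinct [w1, w2, w3]"
        and eq: "equilateral (centroid d w1) (centroid d w2) (centroid d w3)"
        and T: "T = {cell w1, cell w2, cell w3}"
        unfolding E_set_def by auto
      have "w1 \<noteq> w2" using ne by simp
      moreover from this have "cell w1 \<noteq> cell w2" using w inj_on_cell by (metis inj_onD)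
      moreover have "cell w1 \<in> board n" "cell w2 \<in> board n" "cell w3 \<in> board n"
        using w cell_image_words by blast+
      ultimately show "T \<in> ?G"
        unfolding T using equilateral_in_grid_triangles eq equilateral_centroid_iff[OF d w] by blast
    qed
    show "?G \<subseteq> image cell ` E_set d n"
    proof
      fix T assume "T \<in> ?G"
      then obtain s where s: "s = 2 ^ n - 1 \<or> s = 2 ^ n - 2" and T: "T \<in> grid_triangles s" by blast
      obtain p q r where pqr: "T = {p, q, r}" "distinct [p, q, r]" "{p, q, r} \<subseteq> grid s"
        using grid_triangle_three_cells[OF T] .
      have "{p, q, r} \<subseteq> cell ` words n"
        using pqr(3) s by (auto simp: cell_image_words board_def)
      then obtain w1 w2 w3 where w: "w1 \<in> words n" "w2 \<in> words n" "w3 \<in> words n"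
        and c: "p = cell w1" "q = cell w2" "r = cell w3" by auto
      obtain N where N: "\<And>p q. p \<in> T \<Longrightarrow> q \<in> T \<Longrightarrow> p \<noteq> q \<Longrightarrow> hex_form (p - q) = N"
        using grid_triangle_equilateral[OF T] by blast
      moreover have "p \<in> T" "q \<in> T" "r \<in> T" "p \<noteq> q" "q \<noteq> r" "r \<noteq> p" using pqr by auto
      ultimately have "hex_form (p - q) = N" "hex_form (q - r) = N" "hex_form (r - p) = N"
        by simp_all
      then have "equilateral (centroid d w1) (centroid d w2) (centroid d w3)"
        using equilateral_centroid_iff[OF d w] pqr(2) c by auto
      moreover have "distinct [w1, w2, w3]" using pqr(2) c by auto
      ultimately have "{w1, w2, w3} \<in> E_set d n" unfolding E_set_def using w by blast
      moreover have "T = cell ` {w1, w2, w3}" using pqr(1) c by simp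
      ultimately show "T \<in> image cell ` E_set d n" by blast
    qed
  qed
qed


section \<open>Counting the triangles of the board\<close>

text \<open>The triangle inscribed in the untilted triangle that lies at distances $A$, $B$, $C$ from the
  sides of the array and has side $u + w$; its vertices divide the sides of that triangle in the
  ratio $u : w$. The successor makes $w$ positive: $u = 0$ gives the untilted triangle itself, and
  $w = 0$ would give it a second time.\<close>

definition inscribed_triangle :: "nat list \<Rightarrow> (int \<times> int \<times> int) set" where
  "inscribed_triangle l = (let A = int (l ! 0); B = int (l ! 1); C = int (l ! 2);
      u = int (l ! 3); w = int (l ! 4) + 1
    in {(A + w, B + u, C), (A, B + w, C + u), (A + u, B, C + w)})"

text \<open>The numbers $A$, $B$, $C$ are the minima of the coordinates over the vertices.\<close>

lemma inscribed_triangle_inj: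
  fixes A B C u w A' B' C' u' w' :: int
  assumes eq: "{(A + w, B + u, C), (A, B + w, C + u), (A + u, B, C + w)}
      = {(A' + w', B' + u', C'), (A', B' + w', C' + u'), (A' + u', B', C' + w')}" (is "?T = ?T'")
    and pos: "u \<ge> 0" "u' \<ge> 0" "w \<ge> 1" "w' \<ge> 1"
  shows "A = A' \<and> B = B' \<and> C = C' \<and> u = u' \<and> w = w'"
proof -
  have "(A, B + w, C + u) \<in> ?T'" "(A + u, B, C + w) \<in> ?T'" "(A + w, B + u, C) \<in> ?T'"
    unfolding eq[symmetric] by simp_all
  then have 1: "A' \<le> A" "B' \<le> B" "C' \<le> C" using pos by auto
  have "(A', B' + w', C' + u') \<in> ?T" "(A' + u', B', C' + w') \<in> ?T" "(A' + w', B' + u', C') \<in> ?T"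
    unfolding eq by simp_all
  then have "A \<le> A'" "B \<le> B'" "C \<le> C'" using pos by auto
  with 1 have ABC: "A = A'" "B = B'" "C = C'" by simp_all
  moreover have "(A + w, B + u, C) \<in> ?T'" unfolding eq[symmetric] by simp
  then have "u = u' \<and> w = w'" using pos unfolding ABC by auto
  ultimately show ?thesis by simp
qed

text \<open>Conversely, the circumscribed untilted triangle of a given equilateral triangle is found by
  starting the path of its sides at a suitable vertex: a step $(x, y, z)$ with $x < 0 \le z$ has
  the form $(-w, w - u, u)$. One of the three steps is like that, because the nonzero coordinates of
  a vector of sum zero do not all have the same sign, so that somewhere in cyclic order a nonnegative
  coordinate is followed by a negative one.\<close>

lemma bij_betw_inscribed_triangle:
  "bij_betw inscribed_triangle {l. length l = 5 \<and> sum_list l = N} (grid_triangles (int N + 1))"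
  (is "bij_betw _ ?Q ?G")
  unfolding bij_betw_def
proof
  have length5: "length l = 5 \<Longrightarrow> \<exists>A B C u w. l = [A, B, C, u, w]" for l :: "nat list"
    by (auto simp: numeral_eq_Suc length_Suc_conv)
  show "inj_on inscribed_triangle ?Q"
  proof (rule inj_onI)
    fix l l' assume "l \<in> ?Q" "l' \<in> ?Q" and eq: "inscribed_triangle l = inscribed_triangle l'"
    then have "length l = 5" "length l' = 5" by simp_all
    then obtain A B C u w A' B' C' u' w' where l: "l = [A, B, C, u, w]" "l' = [A', B', C', u', w']"
      using length5 by meson
    show "l = l'"
      using inscribed_triangle_inj[OF eq[unfolded l inscribed_triangle_def Let_def]]
      by (simp add: l)
  qed
  show "inscribed_triangle ` ?Q = ?G"
  proof
    show "inscribed_triangle ` ?Q \<subseteq> ?G"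
    proof
      fix T assume "T \<in> inscribed_triangle ` ?Q"
      then obtain l where "l \<in> ?Q" and T: "T = inscribed_triangle l" by blast
      then obtain A B C u w where l: "l = [A, B, C, u, w]" and "A + B + C + u + w = N"
        using length5 by fastforce
      then have N: "int N = int A + int B + int C + int u + int w" by simp
      show "T \<in> ?G"
        \<comment> \<open>the side leading from the vertex with third coordinate $C$ to the one with first coordinate $A$\<close>
        unfolding T l inscribed_triangle_def Let_def
        by (rule grid_trianglesI[of "- int w - 1" "int w + 1 - int u" "int u"])
          (simp_all add: grid_def N)
    qed
    have edge: "{p, p + (x, y, z), p + (x, y, z) + (z, x, y)} \<in> inscribed_triangle ` ?Q"
      if "x + y + z = 0" "x < 0" "z \<ge> 0" and g: "p \<in> grid (int N + 1)"
        "p + (x, y, z) \<in> grid (int N + 1)" "p + (x, y, z) + (z, x, y) \<in> grid (int N + 1)"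
      for p x y z
    proof -
      obtain a b c where p: "p = (a, b, c)" by (cases p)
      \<comment> \<open>The minima of the three coordinates are attained at the second, third and first vertex.\<close>
      define l where "l = [nat (a + x), nat (b - z), nat c, nat z, nat (- x - 1)]"
      have y: "y = - x - z" using that by simp
      have ge: "a + x \<ge> 0" "b - z \<ge> 0" "c \<ge> 0" "a + b + c = int N + 1"
        using g by (auto simp: p grid_def y)
      then have l: "l \<in> ?Q" using that by (auto simp: l_def)
      have "inscribed_triangle l = {p, p + (x, y, z), p + (x, y, z) + (z, x, y)}"
        using ge that by (simp add: l_def inscribed_triangle_def p y algebra_simps)
      then show ?thesis using imageI[OF l, of inscribed_triangle] by (simp only:)
    qed
    show "?G \<subseteq> inscribed_triangle ` ?Q"
    proof
      fix T assume "T \<in> ?G"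
      then obtain p x y z where T: "T = {p, p + (x, y, z), p + (x, y, z) + (z, x, y)}"
        and 0: "x + y + z = 0" "(x, y, z) \<noteq> 0" and g: "p \<in> grid (int N + 1)"
        "p + (x, y, z) \<in> grid (int N + 1)" "p + (x, y, z) + (z, x, y) \<in> grid (int N + 1)"
        unfolding grid_triangles_def by blast
      define q r where qr: "q = p + (x, y, z)" "r = p + (x, y, z) + (z, x, y)"
      have step: "r = q + (z, x, y)" "p = r + (y, z, x)" "q = p + (x, y, z)"
        "r = p + (x, y, z) + (z, x, y)" "p = q + (z, x, y) + (y, z, x)" "q = r + (y, z, x) + (x, y, z)"
        using 0 by (cases p; simp add: qr)+
      note g' = g[folded qr]
      have "x < 0 \<and> z \<ge> 0 \<or> z < 0 \<and> y \<ge> 0 \<or> y < 0 \<and> x \<ge> 0"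
        using 0 by (auto simp: zero_prod_def)
      then consider "x < 0" "z \<ge> 0" | "z < 0" "y \<ge> 0" | "y < 0" "x \<ge> 0" by blast
      then show "T \<in> inscribed_triangle ` ?Q"
      proof cases
        case 1
        with edge 0 g T show ?thesis by blast
      next
        case 2
        have "T = {q, r, p}" unfolding T qr by blast
        moreover have "z + x + y = 0" using 0 by simp
        ultimately show ?thesis
          using edge[of z x y q] 2 g'
          by (simp only: flip: step(1,2))
      next
        case 3
        have "T = {r, p, q}" unfolding T qr by blast
        moreover have "y + z + x = 0" using 0 by simp
        ultimately show ?thesis
          using edge[of y z x r] 3 g'
          by (simp only: flip: step(2,3))
      qed
    qed
  qed
qed

text \<open>Stars and bars for the $5$-tuples of sum $s - 1$. The array with a single dot, $s = 0$, is
  covered as well: it has no triangles.\<close>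

lemma finite_card_grid_triangles:
  "finite (grid_triangles (int s)) \<and> card (grid_triangles (int s)) = (s + 3) choose 4"
proof (cases s)
  case 0
  have "grid_triangles 0 = {}"
    unfolding grid_triangles_def grid_def by (auto simp: zero_prod_def)
  then show ?thesis using 0 by (simp add: binomial_eq_0)
next
  case (Suc N)
  have card: "card (grid_triangles (int s)) = (N + 4) choose N"
    using bij_betw_same_card[OF bij_betw_inscribed_triangle[of N]] card_length_sum_list[of 5 N]
    by (simp add: Suc add.commute)
  then have "card (grid_triangles (int s)) > 0" by simp
  then have "finite (grid_triangles (int s))" using card_ge_0_finite by blast
  moreover have "(s + 3) choose 4 = (N + 4) choose N"
    using binomial_symmetric[of N "N + 4"] by (simp add: Suc add.commute)
  ultimately show ?thesis using card by simp
qed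

lemma choose_4: "24 * ((s + 3) choose 4) = s * (s + 1) * (s + 2) * (s + 3)"
proof -
  have "4 * ((s + 3) choose 4) = (s + 3) * ((s + 2) choose 3)"
    using Suc_times_binomial_eq[of "s + 2" 3] by (simp add: numeral_eq_Suc)
  moreover have "3 * ((s + 2) choose 3) = (s + 2) * ((s + 1) choose 2)"
    using Suc_times_binomial_eq[of "s + 1" 2] by (simp add: numeral_eq_Suc)
  moreover have "2 * ((s + 1) choose 2) = (s + 1) * s"
    using Suc_times_binomial_eq[of "s" 1] by (simp add: numeral_eq_Suc)
  ultimately show ?thesis by algebra
qed

lemma finite_card_E_set:
  assumes "d > 0" "n \<ge> 1"
  shows "finite (E_set d n)" "12 * card (E_set d n) + 4 ^ n = 16 ^ n"
proof -
  have "2 ^ 1 \<le> (2 ^ n :: nat)" using assms by (intro power_increasing) auto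
  then obtain k :: nat where k: "2 ^ n = k + 2" using le_Suc_ex[of 2 "2 ^ n"] by auto
  then have k': "2 ^ n = int k + 2" by (metis of_nat_add of_nat_numeral of_nat_power)
  \<comment> \<open>Put $k = 2^n - 2$, a natural number as $n \ge 1$; the two arrays are those of sums $k + 1$ and $k$.\<close>
  have G: "bij_betw (image cell) (E_set d n) (grid_triangles (int (k + 1)) \<union> grid_triangles (int k))"
    using bij_betw_E_set[OF assms(1), of n] by (simp add: k' add.commute)
  have "finite (grid_triangles (int (k + 1)) \<union> grid_triangles (int k))"
    using finite_card_grid_triangles by blast
  then show "finite (E_set d n)" using bij_betw_finite[OF G] by blast
  have "grid_triangles (int (k + 1)) \<inter> grid_triangles (int k) = {}"
    by (rule grid_triangles_disjoint) simp
  then have "card (E_set d n) = ((k + 1 + 3) choose 4) + ((k + 3) choose 4)"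
    using bij_betw_same_card[OF G] finite_card_grid_triangles by (metis card_Un_disjoint)
  then have "24 * card (E_set d n)
      = (k + 1) * (k + 1 + 1) * (k + 1 + 2) * (k + 1 + 3) + k * (k + 1) * (k + 2) * (k + 3)"
    using choose_4[of k] choose_4[of "k + 1"] by (simp only: distrib_left)
  then have "12 * card (E_set d n) + (k + 2)\<^sup>2 = (k + 2) ^ 4"
    by (simp add: power2_eq_square power4_eq_xxxx algebra_simps)
  moreover have "((2::nat) ^ n)\<^sup>2 = (2\<^sup>2) ^ n" "((2::nat) ^ n) ^ 4 = (2 ^ 4) ^ n"
    by (simp_all only: power_mult[symmetric] mult.commute)
  then have "(k + 2)\<^sup>2 = 4 ^ n" "(k + 2) ^ 4 = 16 ^ n"
    by (simp_all add: k)
  ultimately show "12 * card (E_set d n) + 4 ^ n = 16 ^ n" by simp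
qed

section \<open>The local class\<close>

lemma gam_gam_gam: "gam (gam (gam x)) = x"
  by (cases x) auto

lemma gam_eq_iff: "gam x = x \<longleftrightarrow> x = Qe" "gam (gam x) = x \<longleftrightarrow> x = Qe" "gam x = Qe \<longleftrightarrow> x = Qe"
  by (cases x; simp)+

lemma length_gam_on [simp]: "length (gam_on S b) = length b"
  by (simp add: gam_on_def)

lemma nth_gam_on [simp]:
  "r < length b \<Longrightarrow> gam_on S b ! r = (if r \<in> S then gam (b ! r) else b ! r)"
  by (simp add: gam_on_def)

lemma supp_gam_on [simp]: "supp (gam_on S b) = supp b"
  by (auto simp: supp_def gam_eq_iff split: if_splits)

lemma gam_on_cube: "gam_on S (gam_on S (gam_on S b)) = b"
  by (rule nth_equalityI) (simp_all add: gam_gam_gam)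

lemma T_set_gam_on: "T_set (gam_on S b) S = T_set b S"
  by (auto simp: T_set_def gam_on_cube)

lemma gam_on_distinct:
  assumes "S \<noteq> {}" "S \<subseteq> supp b"
  shows "distinct [b, gam_on S b, gam_on S (gam_on S b)]"
proof -
  obtain r where "r \<in> S" "r < length b" "b ! r \<noteq> Qe"
    using assms by (auto simp: supp_def)
  then have "b ! r \<noteq> gam_on S b ! r" "b ! r \<noteq> gam_on S (gam_on S b) ! r"
      "gam_on S b ! r \<noteq> gam_on S (gam_on S b) ! r"
    using gam_eq_iff by (metis length_gam_on nth_gam_on)+
  then show ?thesis by auto
qed

text \<open>Since $\gamma$ moves every letter other than \<open>Qe\<close>, the set $S$ consists of the positions where the
  words of $T(b, S)$ disagree; hence the triple determines $S$.\<close>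

lemma support_of_T_set:
  assumes "S \<subseteq> supp b"
  shows "S = {r. r < length b \<and> (\<exists>x\<in>T_set b S. \<exists>y\<in>T_set b S. x ! r \<noteq> y ! r)}"
proof (intro set_eqI iffI)
  fix r assume "r \<in> S"
  then have "r < length b" "b ! r \<noteq> gam_on S b ! r"
    using assms gam_eq_iff(1)[of "b ! r"] by (auto simp: supp_def)
  then show "r \<in> {r. r < length b \<and> (\<exists>x\<in>T_set b S. \<exists>y\<in>T_set b S. x ! r \<noteq> y ! r)}"
    unfolding T_set_def by blast
next
  fix r assume r: "r \<in> {r. r < length b \<and> (\<exists>x\<in>T_set b S. \<exists>y\<in>T_set b S. x ! r \<noteq> y ! r)}"
  then obtain x y where xy: "x \<in> T_set b S" "y \<in> T_set b S" "x ! r \<noteq> y ! r" by blast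
  show "r \<in> S"
  proof (rule ccontr)
    assume "r \<notin> S"
    then have "x ! r = b ! r" if "x \<in> T_set b S" for x
      using that r by (auto simp: T_set_def)
    from this[OF xy(1)] this[OF xy(2)] xy(3) show False by simp
  qed
qed

definition local_data :: "nat \<Rightarrow> (symb list \<times> nat set) set" where
  "local_data n = (SIGMA b : words n. Pow (supp b) - {{}})"

lemma L_set_eq_image: "L_set n = (\<lambda>(b, S). T_set b S) ` local_data n"
  unfolding L_set_def local_data_def by (auto simp: image_iff)

text \<open>Each coordinate contributes a factor $1 + 2 + 2 + 2$: a letter \<open>Qe\<close> outside the chosen subset of the
  support, or one of three letters inside or outside of it.\<close>

lemma sum_two_power_supp: "(\<Sum>b\<in>words n. 2 ^ card (supp b)) = (7 ^ n :: nat)"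
proof (induction n)
  case 0
  then show ?case by (simp add: words_def supp_def)
next
  case (Suc n)
  have supp: "card (supp (x # w)) = (if x = Qe then 0 else 1) + card (supp w)" for x w
  proof -
    have "supp (x # w) = (if x = Qe then {} else {0}) \<union> Suc ` supp w" (is "?l = ?r")
    proof (rule set_eqI)
      show "s \<in> ?l \<longleftrightarrow> s \<in> ?r" for s by (cases s) (auto simp: supp_def)
    qed
    moreover have "finite (supp w)" by (simp add: supp_def)
    ultimately show ?thesis by (simp add: card_image card_insert_if image_iff)
  qed
  have "(\<Sum>b\<in>words (Suc n). 2 ^ card (supp b))
      = (\<Sum>(x, w)\<in>UNIV \<times> words n. 2 ^ card (supp (x # w)) :: nat)"
    unfolding words_Suc by (subst sum.reindex) (auto simp: inj_on_def intro: sum.cong)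
  also have "\<dots> = (\<Sum>x\<in>UNIV. \<Sum>w\<in>words n. 2 ^ card (supp (x # w)))"
    by (simp add: sum.cartesian_product)
  also have "\<dots> = 7 * (\<Sum>w\<in>words n. 2 ^ card (supp w))"
    by (simp add: UNIV_symb supp flip: sum_distrib_left)
  finally show ?case using Suc by simp
qed

lemma card_local_data: "finite (local_data n)" "card (local_data n) + 4 ^ n = 7 ^ n"
proof -
  have fin: "finite (supp b)" for b by (simp add: supp_def)
  show "finite (local_data n)" unfolding local_data_def using finite_words fin by auto
  have "card (local_data n) = (\<Sum>b\<in>words n. card (Pow (supp b) - {{}}))"
    unfolding local_data_def using finite_words fin by (intro card_SigmaI) auto
  also have "\<dots> = (\<Sum>b\<in>words n. 2 ^ card (supp b) - 1)"
    using fin by (simp add: card_Diff_subset card_Pow)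
  finally have "card (local_data n) + card (words n)
      = (\<Sum>b\<in>words n. (2 ^ card (supp b) - 1) + 1)"
    unfolding sum.distrib by simp
  then show "card (local_data n) + 4 ^ n = 7 ^ n"
    by (simp add: sum_two_power_supp card_words)
qed

text \<open>The map $(b, S) \mapsto T(b, S)$ is three-to-one: $S$ is determined by the image, and \<open>b\<close> may be any
  of its three elements.\<close>

lemma card_L_set: "3 * card (L_set n) + 4 ^ n = 7 ^ n"
proof -
  let ?T = "\<lambda>(b, S). T_set b S"
  have fibre: "card {z \<in> local_data n. ?T z = T} = 3" if "T \<in> L_set n" for T
  proof -
    obtain b S where bS: "b \<in> words n" "S \<noteq> {}" "S \<subseteq> supp b" and T: "T = T_set b S"
      using \<open>T \<in> L_set n\<close> unfolding L_set_def by blast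
    have "{z \<in> local_data n. ?T z = T} = (\<lambda>b'. (b', S)) ` T_set b S" (is "?F = ?I")
    proof
      show "?F \<subseteq> ?I"
      proof
        fix z assume "z \<in> ?F"
        then obtain b' S' where z: "z = (b', S')" "b' \<in> words n" "S' \<subseteq> supp b'"
          and eq: "T_set b' S' = T_set b S"
          unfolding local_data_def T by auto
        have "length b' = length b" using bS z by (simp add: words_def)
        then have "S' = S"
          using support_of_T_set[OF bS(3)] support_of_T_set[OF z(3)] by (simp only: eq)
        moreover have "b' \<in> T_set b S" using eq by (auto simp: T_set_def)
        ultimately show "z \<in> ?I" using z by blast
      qed
      show "?I \<subseteq> ?F"
        using bS T_set_gam_on[of S b] T_set_gam_on[of S "gam_on S b"]
        by (auto simp: T local_data_def T_set_def[of b S] words_def)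
    qed
    moreover have "card (T_set b S) = 3"
      using distinct_card[OF gam_on_distinct[OF bS(2,3)]] by (simp add: T_set_def)
    ultimately show ?thesis by (simp add: card_image inj_on_def)
  qed
  have "card (local_data n) = (\<Sum>T\<in>L_set n. card {z \<in> local_data n. ?T z = T})"
    using sum.image_gen[OF card_local_data(1)[of n], of "\<lambda>_. 1 :: nat" ?T]
    by (simp add: L_set_eq_image)
  also have "\<dots> = 3 * card (L_set n)" using fibre by simp
  finally show ?thesis using card_local_data(2)[of n] by simp
qed

text \<open>The rotation by $-120$ degrees, which takes $v(i)$ to $v(j)$, $v(j)$ to $v(k)$ and $v(k)$ to
  $v(i)$.\<close>

definition rot :: "real ^ 2 \<Rightarrow> real ^ 2" where
  "rot x = vector [sqrt 3 / 2 * x $ 2 - x $ 1 / 2, - (sqrt 3 / 2 * x $ 1) - x $ 2 / 2]"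

lemma rot_components:
  "rot x $ 1 = sqrt 3 / 2 * x $ 2 - x $ 1 / 2" "rot x $ 2 = - (sqrt 3 / 2 * x $ 1) - x $ 2 / 2"
  by (simp_all add: rot_def)

lemma linear_rot: "linear rot"
  by (rule linearI) (simp_all add: vec_eq_iff forall_2 rot_components field_simps)

lemma rot_cube: "rot (rot (rot x)) = x"
proof -
  have "sqrt 3 * (sqrt 3 * t) = 3 * t" for t :: real
    by (simp flip: mult.assoc)
  note sqrt3 = this
  show ?thesis by (simp add: vec_eq_iff forall_2 rot_components field_simps sqrt3)
qed

lemma norm_rot: "norm (rot x) = norm x"
proof -
  have "(norm (rot x))\<^sup>2 = (norm x)\<^sup>2"
    unfolding power2_norm_eq_inner inner_vec_def sum_2 rot_components inner_real_def
    by (simp add: field_simps)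
  then show ?thesis by simp
qed

lemma v_gam: "v (gam x) = rot (v x)"
  by (cases x) (simp_all add: vec_eq_iff forall_2 rot_components v_components del: v.simps)

lemma sgn_at_gam_on:
  assumes "r \<le> length b"
  shows "sgn_at (gam_on S b) r = sgn_at b r"
proof -
  have "{s. s < r \<and> gam_on S b ! s = Qe} = {s. s < r \<and> b ! s = Qe}"
    using assms by (auto simp: gam_eq_iff split: if_splits)
  then show ?thesis by (simp add: sgn_at_def)
qed

text \<open>The positions outside $S$ contribute a fixed vector $f$ to the centroid, those in $S$ a vector $g$
  that $\gamma_S$ rotates. So the three centroids are $f + g$, $f + \rho g$, $f + \rho^2 g$ with
  the rotation $\rho$ of order three, which permutes the sides of this triangle.\<close>

lemma T_set_in_E_set:
  assumes d: "d > 0" and bS: "b \<in> words n" "S \<noteq> {}" "S \<subseteq> supp b"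
  shows "T_set b S \<in> E_set d n"
proof -
  define part where "part R b = (\<Sum>r\<in>R. (sgn_at b r * dlen d (r + 1)) *\<^sub>R v (b ! r))" for R b
  have S: "S \<subseteq> {..<length b}" using bS by (auto simp: supp_def)
  have split: "centroid d b' = part ({..<length b} - S) b' + part S b'" if "length b' = length b" for b'
    unfolding centroid_def part_def that using S by (intro sum.subset_diff) auto
  have fixed: "part ({..<length b} - S) (gam_on S b') = part ({..<length b} - S) b'"
    if "length b' = length b" for b'
    unfolding part_def using that by (intro sum.cong) (auto simp: sgn_at_gam_on)
  have rotated: "part S (gam_on S b') = rot (part S b')" if "length b' = length b" for b'
    unfolding part_def linear_sum[OF linear_rot]
    using that S by (intro sum.cong) (auto simp: sgn_at_gam_on v_gam linear_cmul[OF linear_rot])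
  define f g where "f = part ({..<length b} - S) b" "g = part S b"
  have c: "centroid d b = f + g" "centroid d (gam_on S b) = f + rot g"
    "centroid d (gam_on S (gam_on S b)) = f + rot (rot g)"
    by (simp_all add: split fixed rotated f_g_def)
  note diff = linear_diff[OF linear_rot]
  have "dist (f + rot g) (f + rot (rot g)) = norm (rot (g - rot g))"
    "dist (f + rot (rot g)) (f + g) = norm (rot (rot (g - rot g)))"
    "dist (f + g) (f + rot g) = norm (g - rot g)"
    by (simp_all add: dist_norm diff rot_cube)
  moreover have dist: "distinct [b, gam_on S b, gam_on S (gam_on S b)]"
    using gam_on_distinct bS by blast
  have w: "gam_on S b \<in> words n" "gam_on S (gam_on S b) \<in> words n"
    using bS by (simp_all add: words_def)
  then have "centroid d b \<noteq> centroid d (gam_on S b)"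
    using centroid_inj[OF d bS(1)] dist by simp
  ultimately have "equilateral (centroid d b) (centroid d (gam_on S b)) (centroid d (gam_on S (gam_on S b)))"
    unfolding equilateral_iff c by (simp add: norm_rot)
  then show ?thesis
    unfolding E_set_def T_set_def using bS w dist by blast
qed

lemma L_set_subset_E_set: "d > 0 \<Longrightarrow> L_set n \<subseteq> E_set d n"
  unfolding L_set_def using T_set_in_E_set by blast

section \<open>The nonlocal triangles\<close>

theorem corollary5p9:
  fixes d1 :: real
  assumes "d1 > 0"
  shows "(\<forall>n\<ge>1.
            real (card (X_set d1 n)) = real (card (E_set d1 n)) - real (card (L_set n)) \<and>
            real (card (E_set d1 n)) - real (card (L_set n))
              = (16 ^ n + 3 * 4 ^ n - 4 * 7 ^ n) / 12) \<and>
         map (\<lambda>n. card (X_set d1 n)) [1, 2, 3, 4, 5, 6] = [0, 9, 243, 4725, 82035, 1359909] \<and>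
         (\<lambda>n. real (card (L_set n)) / real (card (E_set d1 n)))
           \<sim>[sequentially] (\<lambda>n. 4 * (7 / 16) ^ n)"
proof -
  have L: "real (card (L_set n)) = (7 ^ n - 4 ^ n) / 3" for n
  proof -
    have "real (3 * card (L_set n) + 4 ^ n) = real (7 ^ n)" by (simp only: card_L_set)
    then show ?thesis by simp
  qed
  have E: "real (card (E_set d1 n)) = (16 ^ n - 4 ^ n) / 12" if "n \<ge> 1" for n
  proof -
    have "real (12 * card (E_set d1 n) + 4 ^ n) = real (16 ^ n)"
      by (simp only: finite_card_E_set(2)[OF assms that])
    then show ?thesis by simp
  qed
  have X: "real (card (X_set d1 n)) = real (card (E_set d1 n)) - real (card (L_set n))"
    if "n \<ge> 1" for n
  proof -
    have fin: "finite (E_set d1 n)" by (rule finite_card_E_set(1)[OF assms that])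
    note sub = L_set_subset_E_set[OF assms, of n]
    have "card (X_set d1 n) = card (E_set d1 n) - card (L_set n)"
      unfolding X_set_def using finite_subset[OF sub fin] sub by (rule card_Diff_subset)
    with card_mono[OF fin sub] show ?thesis by simp
  qed
  have EL: "real (card (E_set d1 n)) - real (card (L_set n)) = (16 ^ n + 3 * 4 ^ n - 4 * 7 ^ n) / 12"
    if "n \<ge> 1" for n
    using L[of n] E[OF that] by (simp add: field_simps)
  have Xn: "real (card (X_set d1 n)) = (16 ^ n + 3 * 4 ^ n - 4 * 7 ^ n) / 12" if "n \<ge> 1" for n
    using X[OF that] EL[OF that] by simp
  have "map (\<lambda>n. card (X_set d1 n)) [1, 2, 3, 4, 5, 6] = [0, 9, 243, 4725, 82035, 1359909]"
    using Xn[of 1] Xn[of 2] Xn[of 3] Xn[of 4] Xn[of 5] Xn[of 6] by simp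
  moreover have "(\<lambda>n. real (card (L_set n)) / real (card (E_set d1 n)))
      \<sim>[sequentially] (\<lambda>n. 4 * (7 / 16) ^ n)"
  proof (rule asymp_equivI')
    \<comment> \<open>Dividing by $7^n$ and $16^n$ in the closed forms, the quotient of both sides is
      $(1 - (4/7)^n) / (1 - (1/4)^n)$.\<close>
    have "(\<lambda>n. (1 - (4 / 7) ^ n) / (1 - (1 / 4) ^ n)) \<longlonglongrightarrow> (1 - 0) / (1 - 0 :: real)"
      by (intro tendsto_intros LIMSEQ_realpow_zero) auto
    moreover have "\<forall>\<^sub>F n in sequentially. (1 - (4 / 7) ^ n) / (1 - (1 / 4) ^ n)
        = real (card (L_set n)) / real (card (E_set d1 n)) / (4 * (7 / 16) ^ n)"
      using eventually_ge_at_top[of 1]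
    proof eventually_elim
      case (elim n)
      have "(4 / 7 :: real) ^ n = 4 ^ n / 7 ^ n" "(1 / 4 :: real) ^ n = 4 ^ n / 16 ^ n"
        "(7 / 16 :: real) ^ n = 7 ^ n / 16 ^ n"
        by (simp_all flip: power_divide)
      moreover have "(4 :: real) ^ n < 16 ^ n"
        using elim by (intro power_strict_mono) auto
      ultimately show ?case
        by (simp add: L E[OF elim] divide_simps) (simp add: algebra_simps)
    qed
    ultimately show "(\<lambda>n. real (card (L_set n)) / real (card (E_set d1 n)) / (4 * (7 / 16) ^ n))
        \<longlonglongrightarrow> 1"
      by (simp add: tendsto_cong)
  qed
  ultimately show ?thesis using X EL by blast
qed

end
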